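(* Let $N\ge 2$ be an integer and let $A$ be an $N\times N$ complex unitary matrix all of whose first-row entries equal $1/\sqrt N$. Let $(W_{n,A})_{n\ge 0}$ be the generalized Walsh functions associated to $A$. For every $f\in L^1[0,1]$, the sequence of partial sums $$S_{N^q}(x)=\sum_{n=0}^{N^q-1}\langle f, W_{n,A}\rangle W_{n,A}(x),\qquad q=1,2,3,\dots$$ converges to $f(x)$ as $q\to\infty$ for almost every $x\in[0,1]$ (Lebesgue measure).
   Context: Generalized Walsh functions. Write $A=[a_{ij}]_{0\le i,j\le N-1}$, a complex unitary $N\times N$ matrix with $a_{0j}=1/\sqrt N$ for all $j$. For $0\le i\le N-1$ let $m_i(x)=\sqrt N\sum_{j=0}^{N-1}a_{ij}\chi_{[j/N,(j+1)/N)}(x)$ for $x\in[0,1)$, so $m_0\equiv 1$. Let $r(x)=(Nx)\bmod 1$, i.e. $r(x)=Nx-l$ for $x\in[l/N,(l+1)/N)$, $l\in\{0,\dots,N-1\}$. At the endpoint $x=1$ the convention is $r(1)=1$ and $m_i(1)=\sqrt N a_{i,N-1}$. For an integer $n\ge 0$ with base-$N$ expansion $n=\sum_{k=0}^{p-1}i_kN^k$, $i_k\in\{0,\dots,N-1\}$, set $$W_{n,A}(x)=m_{i_0}(x)\,m_{i_1}(r x)\cdots m_{i_{p-1}}(r^{p-1}x),$$ where $r^k$ is the $k$-fold iterate of $r$; $W_{0,A}\equiv1$. Functions are complex valued and $\langle f,g\rangle=\int_0^1 f(t)\overline{g(t)}\,dt$. *)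

theory Defs
  imports "HOL-Analysis.Analysis" "Jordan_Normal_Form.Schur_Decomposition"
begin

definition unitary_mat :: "nat \<Rightarrow> complex mat \<Rightarrow> bool" where
  "unitary_mat N A \<longleftrightarrow> A \<in> carrier_mat N N \<and>
     A * mat_adjoint A = 1\<^sub>m N \<and> mat_adjoint A * A = 1\<^sub>m N"

text \<open>The maps below are only meaningful on the closed interval from 0 to 1. The endpoint 1
  is treated separately, as a fixed point of the shift lying in the last subinterval.\<close>

definition walsh_m :: "nat \<Rightarrow> complex mat \<Rightarrow> nat \<Rightarrow> real \<Rightarrow> complex" where
  "walsh_m N A i x =
     (if x = 1 then complex_of_real (sqrt (real N)) * A $$ (i, N - 1)
      else complex_of_real (sqrt (real N)) *
        (\<Sum>j<N. A $$ (i, j) * indicator {real j / real N ..< (real j + 1) / real N} x))"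

definition walsh_r :: "nat \<Rightarrow> real \<Rightarrow> real" where
  "walsh_r N x = (if x = 1 then 1 else frac (real N * x))"

text \<open>\<open>num_digits N n\<close> is the length of the base-\<open>N\<close> expansion of \<open>n\<close> without leading zeros
  (for \<open>N \<ge> 2\<close>; it is 0 for \<open>n = 0\<close>), and the \<open>k\<close>-th digit is \<open>(n div N ^ k) mod N\<close>.
  When \<open>walsh_m N A 0\<close> is constantly 1, leading zeros would not change the product.\<close>

definition num_digits :: "nat \<Rightarrow> nat \<Rightarrow> nat" where
  "num_digits N n = (LEAST p. n < N ^ p)"

definition walsh_W :: "nat \<Rightarrow> complex mat \<Rightarrow> nat \<Rightarrow> real \<Rightarrow> complex" where
  "walsh_W N A n x =
     (\<Prod>k<num_digits N n. walsh_m N A ((n div N ^ k) mod N) ((walsh_r N ^^ k) x))"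

definition L2_inner :: "(real \<Rightarrow> complex) \<Rightarrow> (real \<Rightarrow> complex) \<Rightarrow> complex" where
  "L2_inner f g = (LINT t|lebesgue_on {0..1}. f t * cnj (g t))"

definition walsh_partial_sum ::
  "nat \<Rightarrow> complex mat \<Rightarrow> (real \<Rightarrow> complex) \<Rightarrow> nat \<Rightarrow> real \<Rightarrow> complex" where
  "walsh_partial_sum N A f M x = (\<Sum>n<M. L2_inner f (walsh_W N A n) * walsh_W N A n x)"

end

theory Submission
  imports Defs
begin

text \<open>
  The partial sum of length \<open>N ^ q\<close> is an integral operator with the Dirichlet kernel
  \<open>K\<^sub>q(x, t) = (\<Sum>n<N ^ q. W\<^sub>n(x) * cnj (W\<^sub>n(t)))\<close>. As \<open>n\<close> runs below \<open>N ^ q\<close>, its \<open>q\<close> digits run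
  independently through \<open>{0..<N}\<close>, because padding with leading zeros multiplies \<open>W\<^sub>n\<close> by values
  of \<open>m\<^sub>0 = 1\<close>. So \<open>K\<^sub>q\<close> is a product over \<open>k < q\<close> of sums
  \<open>\<Sum>i<N. m\<^sub>i(r\<^sup>k x) * cnj (m\<^sub>i(r\<^sup>k t))\<close>. Such a sum is \<open>N\<close> times the inner product of two columns
  of the unitary matrix, namely those indexed by the \<open>k\<close>-th base-\<open>N\<close> digits of \<open>x\<close> and of \<open>t\<close>.
  It is \<open>N\<close> if these digits agree and vanishes otherwise. Hence \<open>K\<^sub>q(x, t)\<close> is \<open>N ^ q\<close> when \<open>x\<close> and
  \<open>t\<close> lie in the same \<open>N\<close>-adic interval of length \<open>1 / N ^ q\<close>, and 0 otherwise
  (\<open>walsh_kernel\<close>); the matrix has disappeared from it.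

  The partial sum at \<open>x\<close> is therefore the mean value of \<open>f\<close> over the \<open>N\<close>-adic interval of order
  \<open>q\<close> around \<open>x\<close> (\<open>walsh_partial_sum_eq_average\<close>). These intervals shrink to \<open>x\<close>, and the
  Lebesgue differentiation theorem (\<open>Lebesgue_differentiation_real\<close>) gives convergence to
  \<open>f x\<close> almost everywhere.
\<close>

section \<open>Differentiation of the integral along shrinking intervals\<close>

text \<open>The estimate is multiplied out by the length \<open>h\<close> so that it also holds for \<open>h = 0\<close> and so that
  estimates on adjacent intervals can be added.\<close>

lemma integral_right_increment_estimate:
  fixes g :: "real \<Rightarrow> 'b::euclidean_space"
  assumes "\<And>a b. g integrable_on {a..b}"
  obtains Z where "negligible Z"
    "\<And>x e. x \<notin> Z \<Longrightarrow> 0 < e \<Longrightarrow>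
       \<exists>d>0. \<forall>h. 0 \<le> h \<and> h < d \<longrightarrow>
         norm (integral {x..x + h} g - h *\<^sub>R g x) \<le> e * h"
proof -
  obtain Z where Z: "negligible Z"
    "\<And>x e. x \<notin> Z \<Longrightarrow> 0 < e \<Longrightarrow>
       \<exists>d>0. \<forall>h. 0 < h \<and> h < d \<longrightarrow>
         norm (integral (cbox x (x + h *\<^sub>R One)) g /\<^sub>R h ^ DIM(real) - g x) < e"
    using integrable_ccontinuous_explicit[of g] assms by (auto simp: cbox_interval)
  have "\<exists>d>0. \<forall>h. 0 \<le> h \<and> h < d \<longrightarrow> norm (integral {x..x + h} g - h *\<^sub>R g x) \<le> e * h"
    if x: "x \<notin> Z" and e: "0 < e" for x e
  proof -
    obtain d where d: "d > 0" and
      avg: "\<And>h. 0 < h \<Longrightarrow> h < d \<Longrightarrow> norm (integral {x..x + h} g /\<^sub>R h - g x) < e"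
      using Z(2)[OF x e] by (auto simp: cbox_interval)
    have "norm (integral {x..x + h} g - h *\<^sub>R g x) \<le> e * h" if h: "0 \<le> h" "h < d" for h
    proof (cases "h = 0")
      case False
      then have "integral {x..x + h} g - h *\<^sub>R g x = h *\<^sub>R (integral {x..x + h} g /\<^sub>R h - g x)"
        by (simp add: scaleR_diff_right)
      then have "norm (integral {x..x + h} g - h *\<^sub>R g x)
          = h * norm (integral {x..x + h} g /\<^sub>R h - g x)"
        using h by (simp only: norm_scaleR)
      also have "\<dots> \<le> h * e"
        using avg[of h] False h by (intro mult_left_mono) auto
      finally show ?thesis
        by (simp add: mult.commute)
    qed simp
    with d show ?thesis
      by blast
  qed
  with Z(1) show ?thesis
    using that by blast
qed

text \<open>The point may lie anywhere in the shrinking interval. Cutting the interval at \<open>x\<close> leaves two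
  one-sided increments: the right one is covered by \<open>integral_right_increment_estimate\<close> for \<open>g\<close>, the left one by
  the same lemma for the reflected function \<open>\<lambda>t. g (- t)\<close> at \<open>- x\<close>.\<close>

theorem Lebesgue_differentiation_real:
  fixes g :: "real \<Rightarrow> 'b::euclidean_space"
  assumes int: "\<And>a b. g integrable_on {a..b}"
  obtains Z where "negligible Z"
    "\<And>x e. x \<notin> Z \<Longrightarrow> 0 < e \<Longrightarrow>
       \<exists>d>0. \<forall>a b. a \<le> x \<and> x \<le> b \<and> a < b \<and> b - a < d \<longrightarrow>
         norm (integral {a..b} g /\<^sub>R (b - a) - g x) \<le> e"
proof -
  obtain R where R: "negligible R"
    "\<And>x e. x \<notin> R \<Longrightarrow> 0 < e \<Longrightarrow> \<exists>d>0. \<forall>h. 0 \<le> h \<and> h < d \<longrightarrow>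
         norm (integral {x..x + h} g - h *\<^sub>R g x) \<le> e * h"
    using integral_right_increment_estimate[OF int] by blast
  have int': "(\<lambda>t. g (- t)) integrable_on {a..b}" for a b
    using Henstock_Kurzweil_Integration.integrable_reflect_real[of g "-a" "-b"] int by simp
  obtain L where L: "negligible L"
    "\<And>x e. x \<notin> L \<Longrightarrow> 0 < e \<Longrightarrow> \<exists>d>0. \<forall>h. 0 \<le> h \<and> h < d \<longrightarrow>
         norm (integral {x..x + h} (\<lambda>t. g (- t)) - h *\<^sub>R g (- x)) \<le> e * h"
    using integral_right_increment_estimate[OF int'] by blast
  have "negligible (uminus ` L)"
    using L(1) by (intro negligible_differentiable_image_negligible) (auto intro: derivative_intros)
  with R(1) have "negligible (R \<union> uminus ` L)"
    by (rule negligible_Un)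
  moreover have "\<exists>d>0. \<forall>a b. a \<le> x \<and> x \<le> b \<and> a < b \<and> b - a < d \<longrightarrow>
         norm (integral {a..b} g /\<^sub>R (b - a) - g x) \<le> e"
    if x: "x \<notin> R \<union> uminus ` L" and e: "0 < e" for x e
  proof -
    have "x \<notin> R" "- x \<notin> L"
      using x by (auto simp: image_iff)
    obtain d where d: "d > 0" and right:
      "\<And>h. 0 \<le> h \<Longrightarrow> h < d \<Longrightarrow> norm (integral {x..x + h} g - h *\<^sub>R g x) \<le> e * h"
      using R(2)[OF \<open>x \<notin> R\<close> e] by blast
    obtain d' where d': "d' > 0" and left:
      "\<And>h. 0 \<le> h \<Longrightarrow> h < d' \<Longrightarrow>
         norm (integral {-x..-x + h} (\<lambda>t. g (- t)) - h *\<^sub>R g x) \<le> e * h"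
      using L(2)[OF \<open>- x \<notin> L\<close> e] by auto
    have "norm (integral {a..b} g /\<^sub>R (b - a) - g x) \<le> e"
      if ab: "a \<le> x" "x \<le> b" "a < b" "b - a < min d d'" for a b
    proof -
      have split: "integral {a..b} g = integral {a..x} g + integral {x..b} g"
        using Henstock_Kurzweil_Integration.integral_combine[OF ab(1,2) int] by simp
      have "integral {-x..-x + (x - a)} (\<lambda>t. g (- t)) = integral {a..x} g"
        using Henstock_Kurzweil_Integration.integral_reflect_real[of x a g] by simp
      with left[of "x - a"] ab
      have l: "norm (integral {a..x} g - (x - a) *\<^sub>R g x) \<le> e * (x - a)"
        by simp
      have r: "norm (integral {x..b} g - (b - x) *\<^sub>R g x) \<le> e * (b - x)"
        using right[of "b - x"] ab by simp
      have "integral {a..b} g - (b - a) *\<^sub>R g x =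
          (integral {a..x} g - (x - a) *\<^sub>R g x) + (integral {x..b} g - (b - x) *\<^sub>R g x)"
        by (simp add: split algebra_simps)
      then have "norm (integral {a..b} g - (b - a) *\<^sub>R g x) \<le> e * (x - a) + e * (b - x)"
        using norm_triangle_le[OF add_mono[OF l r]] by simp
      then have *: "norm (integral {a..b} g - (b - a) *\<^sub>R g x) \<le> e * (b - a)"
        by (simp add: algebra_simps)
      have "integral {a..b} g /\<^sub>R (b - a) - g x = (integral {a..b} g - (b - a) *\<^sub>R g x) /\<^sub>R (b - a)"
        using ab by (simp add: scaleR_diff_right)
      then have "norm (integral {a..b} g /\<^sub>R (b - a) - g x)
          = norm (integral {a..b} g - (b - a) *\<^sub>R g x) / (b - a)"
        using ab by (simp only: norm_scaleR) (simp add: divide_inverse mult.commute)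
      also have "\<dots> \<le> e"
        using * ab by (simp add: pos_divide_le_eq)
      finally show ?thesis .
    qed
    with d d' show ?thesis
      by (intro exI[of _ "min d d'"]) auto
  qed
  ultimately show ?thesis
    using that by blast
qed

section \<open>Unitarity and base-\<open>N\<close> digits\<close>

lemma unitary_mat_columns_orthonormal:
  assumes "unitary_mat N A" "j < N" "k < N"
  shows "(\<Sum>i<N. A $$ (i, j) * cnj (A $$ (i, k))) = (if j = k then 1 else 0)"
proof -
  have A: "A \<in> carrier_mat N N" and id: "mat_adjoint A * A = 1\<^sub>m N"
    using assms(1) by (auto simp: unitary_mat_def)
  have "(mat_adjoint A * A) $$ (k, j) = (\<Sum>i<N. A $$ (i, j) * cnj (A $$ (i, k)))"
    using A assms(2,3)
    by (auto simp: mat_adjoint_def scalar_prod_def mat_of_rows_def lessThan_atLeast0 mult.commute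
        intro!: sum.cong)
  with id assms(2,3) show ?thesis
    by auto
qed

lemma floor_mult_unit_interval:
  fixes x :: real
  assumes "N > 0" "0 \<le> x" "x < 1"
  shows "nat \<lfloor>real N * x\<rfloor> < N"
proof -
  have "real N * x < real N"
    using assms by simp
  then have "\<lfloor>real N * x\<rfloor> < int N"
    by linarith
  then show ?thesis
    using assms by linarith
qed

lemma walsh_m_eq:
  assumes "N > 0" "0 \<le> x" "x < 1"
  shows "walsh_m N A i x = complex_of_real (sqrt (real N)) * A $$ (i, nat \<lfloor>real N * x\<rfloor>)"
proof -
  let ?l = "nat \<lfloor>real N * x\<rfloor>"
  have l: "?l < N"
    using floor_mult_unit_interval assms by blast
  have "x \<in> {real j / real N ..< (real j + 1) / real N} \<longleftrightarrow> j = ?l" for j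
  proof -
    have "x \<in> {real j / real N ..< (real j + 1) / real N} \<longleftrightarrow>
        real j \<le> real N * x \<and> real N * x < real j + 1"
      using assms(1) by (auto simp: field_simps)
    also have "\<dots> \<longleftrightarrow> \<lfloor>real N * x\<rfloor> = int j"
      by (auto simp: floor_eq_iff)
    also have "\<dots> \<longleftrightarrow> j = ?l"
      using assms(2) by auto
    finally show ?thesis .
  qed
  then have "(\<Sum>j<N. A $$ (i, j) * indicator {real j / real N ..< (real j + 1) / real N} x)
      = (\<Sum>j<N. if j = ?l then A $$ (i, j) else 0)"
    by (intro sum.cong refl) (auto simp: indicator_def)
  with l assms(3) show ?thesis
    by (simp add: walsh_m_def)
qed

lemma walsh_r_funpow:
  assumes "N > 0" "0 \<le> x" "x < 1"
  shows "(walsh_r N ^^ k) x = frac (real N ^ k * x)"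
proof (induction k)
  case 0
  then show ?case
    using assms by (simp add: frac_eq)
next
  case (Suc k)
  have "real N * frac (real N ^ k * x) =
      real N ^ Suc k * x - of_int (int N * \<lfloor>real N ^ k * x\<rfloor>)"
    by (simp add: frac_def algebra_simps)
  then have "frac (real N * frac (real N ^ k * x)) = frac (real N ^ Suc k * x)"
    by (simp only: frac_def floor_diff_of_int)
  moreover have "frac (real N ^ k * x) \<noteq> 1"
    using frac_lt_1[of "real N ^ k * x"] by linarith
  ultimately show ?case
    using Suc by (simp add: walsh_r_def)
qed

text \<open>Leading zeros are harmless because the first row of the matrix makes \<open>m\<^sub>0 = 1\<close>; with them,
  all \<open>n < N ^ q\<close> have products of the same length \<open>q\<close>.\<close>

lemma walsh_W_padded:
  assumes "N \<ge> 2"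
    and A0: "\<And>j. j < N \<Longrightarrow> A $$ (0, j) = 1 / complex_of_real (sqrt (real N))"
    and "n < N ^ q" "0 \<le> x" "x < 1"
  shows "walsh_W N A n x = (\<Prod>k<q. walsh_m N A (n div N ^ k mod N) ((walsh_r N ^^ k) x))"
proof -
  have "num_digits N n \<le> q"
    unfolding num_digits_def using assms(3) by (rule Least_le)
  have len: "n < N ^ num_digits N n"
    unfolding num_digits_def using assms(3) by (rule LeastI)
  have "walsh_m N A (n div N ^ k mod N) ((walsh_r N ^^ k) x) = 1"
    if "k \<in> {..<q} - {..<num_digits N n}" for k
  proof -
    have "N ^ num_digits N n \<le> N ^ k"
      using that assms(1) by (intro power_increasing) auto
    with len have "n div N ^ k = 0"
      by simp
    moreover have "nat \<lfloor>real N * frac (real N ^ k * x)\<rfloor> < N"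
      using assms(1) by (intro floor_mult_unit_interval) (auto simp: frac_lt_1)
    ultimately show ?thesis
      using assms by (simp add: walsh_r_funpow walsh_m_eq frac_lt_1)
  qed
  then show ?thesis
    unfolding walsh_W_def using \<open>num_digits N n \<le> q\<close>
    by (intro prod.mono_neutral_left) auto
qed

section \<open>The Dirichlet kernel\<close>

text \<open>Two points lie in the same interval of order \<open>q + 1\<close> iff they lie in the same interval of order
  \<open>q\<close> and have the same next digit: multiplying the floor at order \<open>q\<close> by \<open>N\<close> and adding that digit
  yields the floor at order \<open>q + 1\<close>.\<close>

lemma floor_power_Suc_eq_iff:
  fixes t x :: real
  assumes "N > 0"
  shows "\<lfloor>real N ^ Suc q * t\<rfloor> = \<lfloor>real N ^ Suc q * x\<rfloor> \<longleftrightarrow>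
     \<lfloor>real N ^ q * t\<rfloor> = \<lfloor>real N ^ q * x\<rfloor> \<and>
     nat \<lfloor>real N * frac (real N ^ q * t)\<rfloor> = nat \<lfloor>real N * frac (real N ^ q * x)\<rfloor>"
proof -
  define d where "d s = \<lfloor>real N * frac (real N ^ q * s)\<rfloor>" for s :: real
  have bounds: "0 \<le> d s" "d s < int N" for s
    using floor_mult_unit_interval[OF assms, of "frac (real N ^ q * s)"] assms
    by (auto simp: d_def frac_lt_1 nat_less_iff)
  have expand: "\<lfloor>real N ^ Suc q * s\<rfloor> = int N * \<lfloor>real N ^ q * s\<rfloor> + d s" for s
  proof -
    have "real N ^ Suc q * s = real N * frac (real N ^ q * s) + of_int (int N * \<lfloor>real N ^ q * s\<rfloor>)"
      by (simp add: frac_def algebra_simps)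
    then show ?thesis
      by (simp only: d_def flip: floor_add_int)
  qed
  have "\<lfloor>real N ^ Suc q * s\<rfloor> div int N = \<lfloor>real N ^ q * s\<rfloor>"
    "\<lfloor>real N ^ Suc q * s\<rfloor> mod int N = d s" for s
    unfolding expand using bounds assms by auto
  then show ?thesis
    unfolding d_def[symmetric] using bounds expand by (metis nat_eq_iff2 eq_nat_nat_iff)
qed

text \<open>The values \<open>m\<^sub>i(x)\<close>, \<open>i < N\<close>, form \<open>sqrt N\<close> times the matrix column indexed by the leading
  digit of \<open>x\<close>, so the sum is \<open>N\<close> times an inner product of two orthonormal columns.\<close>

lemma digit_kernel:
  assumes "N > 0" "unitary_mat N A" "0 \<le> t" "t < 1" "0 \<le> x" "x < 1"
  shows "(\<Sum>i<N. walsh_m N A i x * cnj (walsh_m N A i t)) =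
    (if nat \<lfloor>real N * t\<rfloor> = nat \<lfloor>real N * x\<rfloor> then of_nat N else 0)"
proof -
  let ?j = "nat \<lfloor>real N * x\<rfloor>" and ?k = "nat \<lfloor>real N * t\<rfloor>"
  have "complex_of_real (sqrt (real N)) * complex_of_real (sqrt (real N)) = of_nat N"
    by (simp flip: of_real_mult)
  then have "walsh_m N A i x * cnj (walsh_m N A i t)
      = of_nat N * (A $$ (i, ?j) * cnj (A $$ (i, ?k)))" for i
    using assms by (simp add: walsh_m_eq algebra_simps)
  then have "(\<Sum>i<N. walsh_m N A i x * cnj (walsh_m N A i t))
      = of_nat N * (\<Sum>i<N. A $$ (i, ?j) * cnj (A $$ (i, ?k)))"
    by (simp add: sum_distrib_left)
  also have "\<dots> = of_nat N * (if ?j = ?k then 1 else 0)"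
    using unitary_mat_columns_orthonormal[OF assms(2)] floor_mult_unit_interval assms by simp
  finally show ?thesis
    by auto
qed

text \<open>Induction on \<open>q\<close>, splitting off the most significant digit \<open>i\<close> of \<open>n = m + i * N ^ q\<close>. This digit
  contributes the factor \<open>m\<^sub>i(r\<^sup>q x)\<close>, which sees exactly the digit of \<open>x\<close> that refines the interval
  of order \<open>q\<close>.\<close>

lemma walsh_kernel:
  assumes "N \<ge> 2" "unitary_mat N A"
    and A0: "\<And>j. j < N \<Longrightarrow> A $$ (0, j) = 1 / complex_of_real (sqrt (real N))"
    and tx: "0 \<le> t" "t < 1" "0 \<le> x" "x < 1"
  shows "(\<Sum>n<N ^ q. walsh_W N A n x * cnj (walsh_W N A n t)) =
    (if \<lfloor>real N ^ q * t\<rfloor> = \<lfloor>real N ^ q * x\<rfloor> then of_nat N ^ q else 0)"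
proof (induction q)
  case 0
  have "\<lfloor>t\<rfloor> = \<lfloor>x\<rfloor>"
    using tx by (simp add: floor_eq_iff[of _ 0] floor_unique[of 0])
  then show ?case
    using walsh_W_padded[OF assms(1) A0, where q = 0 and n = 0] tx by simp
next
  case (Suc q)
  define u where "u s = (walsh_r N ^^ q) s" for s
  have u: "u s = frac (real N ^ q * s)" if "0 \<le> s" "s < 1" for s
    using walsh_r_funpow[of N] assms(1) that by (simp add: u_def)
  have "N > 0"
    using assms(1) by simp
  have step: "walsh_W N A (m + i * N ^ q) s = walsh_W N A m s * walsh_m N A i (u s)"
    if "m < N ^ q" "i < N" "0 \<le> s" "s < 1" for m i s
  proof -
    have "m + i * N ^ q < N ^ q * Suc i"
      using that by simp
    also have "\<dots> \<le> N ^ Suc q"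
      using that by (simp only: power_Suc2 mult_le_mono2 Suc_le_eq)
    finally have lt: "m + i * N ^ q < N ^ Suc q" .
    have low: "(m + i * N ^ q) div N ^ k mod N = m div N ^ k mod N" if "k < q" for k
    proof -
      have "N ^ q = N ^ (Suc (q - Suc k) + k)"
        using \<open>k < q\<close> by simp
      then have shift: "i * N ^ q = (i * N ^ (q - Suc k) * N) * N ^ k"
        by (simp only: power_add power_Suc2 mult.assoc)
      have "(m + i * N ^ q) div N ^ k = i * N ^ (q - Suc k) * N + m div N ^ k"
        unfolding shift using \<open>N > 0\<close> by (intro div_mult_self1) simp
      then show ?thesis
        by simp
    qed
    have top: "(m + i * N ^ q) div N ^ q mod N = i"
      using that by simp
    have "walsh_W N A (m + i * N ^ q) s
        = (\<Prod>k<q. walsh_m N A ((m + i * N ^ q) div N ^ k mod N) ((walsh_r N ^^ k) s)) *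
          walsh_m N A ((m + i * N ^ q) div N ^ q mod N) (u s)"
      using walsh_W_padded[OF assms(1) A0 lt that(3,4)] by (simp only: prod.lessThan_Suc u_def)
    also have "\<dots> = (\<Prod>k<q. walsh_m N A (m div N ^ k mod N) ((walsh_r N ^^ k) s)) *
        walsh_m N A i (u s)"
      unfolding top by (intro arg_cong2[where f = "(*)"] prod.cong refl) (simp add: low)
    also have "\<dots> = walsh_W N A m s * walsh_m N A i (u s)"
      using walsh_W_padded[OF assms(1) A0 that(1,3,4)] by simp
    finally show ?thesis .
  qed
  have "(\<Sum>n<N ^ Suc q. walsh_W N A n x * cnj (walsh_W N A n t))
      = (\<Sum>i<N. \<Sum>n\<in>{i * N ^ q..<i * N ^ q + N ^ q}. walsh_W N A n x * cnj (walsh_W N A n t))"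
    by (simp add: sum.nat_group)
  also have "\<dots> = (\<Sum>i<N. \<Sum>m<N ^ q.
      walsh_W N A (m + i * N ^ q) x * cnj (walsh_W N A (m + i * N ^ q) t))"
    using sum.shift_bounds_nat_ivl[of "\<lambda>n. walsh_W N A n x * cnj (walsh_W N A n t)" 0 _ "N ^ q"]
    by (intro sum.cong[OF refl, of "{..<N}"])
      (simp only: lessThan_atLeast0 add_0 add.commute[of _ "N ^ q"])
  also have "\<dots> = (\<Sum>i<N. \<Sum>m<N ^ q. (walsh_m N A i (u x) * cnj (walsh_m N A i (u t))) *
      (walsh_W N A m x * cnj (walsh_W N A m t)))"
    using tx by (intro sum.cong refl) (simp add: step)
  also have "\<dots> = (\<Sum>i<N. walsh_m N A i (u x) * cnj (walsh_m N A i (u t))) *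
      (\<Sum>m<N ^ q. walsh_W N A m x * cnj (walsh_W N A m t))"
    by (simp add: sum_product)
  also have "\<dots> = (if \<lfloor>real N ^ Suc q * t\<rfloor> = \<lfloor>real N ^ Suc q * x\<rfloor> then of_nat N ^ Suc q else 0)"
    unfolding Suc floor_power_Suc_eq_iff[OF \<open>N > 0\<close>]
    using digit_kernel[OF \<open>N > 0\<close> assms(2), of "u t" "u x"] tx by (simp add: u frac_lt_1)
  finally show ?case .
qed

section \<open>Partial sums as averages over \<open>N\<close>-adic intervals\<close>

lemma walsh_m_measurable [measurable]: "walsh_m N A i \<in> borel_measurable borel"
  unfolding walsh_m_def by measurable

lemma walsh_r_measurable [measurable]: "walsh_r N \<in> borel_measurable borel"
  unfolding walsh_r_def frac_def by measurable

lemma walsh_W_measurable [measurable]: "walsh_W N A n \<in> borel_measurable borel"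
proof -
  have [measurable]: "(walsh_r N ^^ k) \<in> borel_measurable borel" for k
    by (induction k) auto
  show ?thesis
    unfolding walsh_W_def by measurable
qed

lemma walsh_m_bounded: "\<exists>B. \<forall>x. norm (walsh_m N A i x) \<le> B"
proof (intro exI allI)
  fix x
  let ?S = "\<Sum>j<N. norm (A $$ (i, j))"
  have "norm (\<Sum>j<N. A $$ (i, j) * indicator {real j / real N ..< (real j + 1) / real N} x) \<le> ?S"
    by (intro order_trans[OF norm_sum] sum_mono) (auto simp: norm_mult indicator_def)
  also have "?S \<le> norm (A $$ (i, N - 1)) + ?S"
    by simp
  finally have "norm (\<Sum>j<N. A $$ (i, j) * indicator {real j / real N ..< (real j + 1) / real N} x)
      \<le> norm (A $$ (i, N - 1)) + ?S" .
  moreover have "norm (A $$ (i, N - 1)) \<le> norm (A $$ (i, N - 1)) + ?S"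
    by (simp add: sum_nonneg)
  ultimately show "norm (walsh_m N A i x) \<le> sqrt (real N) * (norm (A $$ (i, N - 1)) + ?S)"
    unfolding walsh_m_def
    by (simp only: norm_mult norm_of_real split: if_split) (auto intro!: mult_left_mono)
qed

lemma walsh_W_bounded: "\<exists>B. \<forall>x. norm (walsh_W N A n x) \<le> B"
proof -
  obtain B where B: "\<And>i x. norm (walsh_m N A i x) \<le> B i"
    using walsh_m_bounded by metis
  have "norm (walsh_W N A n x) \<le> (\<Prod>k<num_digits N n. B (n div N ^ k mod N))" for x
    unfolding walsh_W_def prod_norm[symmetric] by (intro prod_mono) (auto intro: B)
  then show ?thesis
    by blast
qed

text \<open>Exchanging the finite sum with the integral needs each \<open>f * cnj W\<^sub>n\<close> to be integrable, which
  boundedness of \<open>W\<^sub>n\<close> ensures. The kernel formula holds for \<open>t < 1\<close> and selects a half-open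
  interval; the exceptional points \<open>t = 1\<close> and \<open>t = b\<close> form a null set.\<close>

lemma walsh_partial_sum_eq_average:
  fixes f :: "real \<Rightarrow> complex" and q :: nat
  assumes "N \<ge> 2" "unitary_mat N A"
    and A0: "\<And>j. j < N \<Longrightarrow> A $$ (0, j) = 1 / complex_of_real (sqrt (real N))"
    and f: "integrable (lebesgue_on {0..1}) f"
    and x: "0 \<le> x" "x < 1"
  defines "a \<equiv> of_int \<lfloor>real N ^ q * x\<rfloor> / real N ^ q"
  defines "b \<equiv> of_int (\<lfloor>real N ^ q * x\<rfloor> + 1) / real N ^ q"
  shows "walsh_partial_sum N A f (N ^ q) x =
    integral {a..b} (\<lambda>t. if t \<in> {0..1} then f t else 0) /\<^sub>R (b - a)"
proof -
  have N: "real N ^ q > 0"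
    using assms(1) by simp
  have fW: "integrable (lebesgue_on {0..1}) (\<lambda>t. f t * cnj (walsh_W N A n t))" for n
  proof -
    obtain B where B: "\<And>x. norm (walsh_W N A n x) \<le> B"
      using walsh_W_bounded by metis
    have cnj: "cnj \<in> borel_measurable borel"
      by (intro borel_measurable_continuous_onI continuous_intros)
    have meas: "walsh_W N A n \<in> borel_measurable (lebesgue_on {0..1})"
      by (intro measurable_restrict_space1 measurable_completion) simp
    show ?thesis
    proof (rule Bochner_Integration.integrable_bound)
      show "integrable (lebesgue_on {0..1}) (\<lambda>t. B *\<^sub>R f t)"
        using f by simp
      show "(\<lambda>t. f t * cnj (walsh_W N A n t)) \<in> borel_measurable (lebesgue_on {0..1})"
        using f measurable_compose[OF meas cnj] by (intro borel_measurable_times) auto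
      have "norm (f t) * norm (walsh_W N A n t) \<le> \<bar>B\<bar> * norm (f t)" for t
        using B[of t] by (subst mult.commute) (intro mult_right_mono, auto)
      then show "AE t in lebesgue_on {0..1}. norm (f t * cnj (walsh_W N A n t)) \<le> norm (B *\<^sub>R f t)"
        by (simp add: norm_mult)
    qed
  qed
  have cell: "\<lfloor>real N ^ q * t\<rfloor> = \<lfloor>real N ^ q * x\<rfloor> \<longleftrightarrow> a \<le> t \<and> t < b" for t
    using N unfolding a_def b_def floor_eq_iff by (auto simp: field_simps)
  have "AE t in lebesgue. t \<noteq> 1 \<and> t \<noteq> b"
    using AE_completion[OF AE_lborel_singleton[of 1]] AE_completion[OF AE_lborel_singleton[of b]]
    by auto
  then have ne: "AE t in lebesgue_on {0..1}. t \<noteq> 1 \<and> t \<noteq> b"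
    by (subst AE_restrict_space_iff, simp, elim eventually_mono, simp)
  have "real N ^ q * x < of_int (int N ^ q)"
    using N x by simp
  then have "\<lfloor>real N ^ q * x\<rfloor> < int N ^ q"
    by (simp only: floor_less_iff)
  then have "\<lfloor>real N ^ q * x\<rfloor> + 1 \<le> int N ^ q"
    by simp
  then have "real_of_int (\<lfloor>real N ^ q * x\<rfloor> + 1) \<le> real_of_int (int N ^ q)"
    by (simp only: of_int_le_iff)
  moreover have "\<lfloor>real N ^ q * x\<rfloor> \<ge> 0"
    using N x by simp
  ultimately have "0 \<le> a" "b \<le> 1"
    using N by (simp_all add: a_def b_def)
  then have "{a..b} \<in> sets (lebesgue_on {0..1})"
    by (intro sets_restrict_space_iff[THEN iffD2]) auto
  then have int: "integrable (lebesgue_on {0..1}) (\<lambda>t. indicator {a..b} t *\<^sub>R (real N ^ q *\<^sub>R f t))"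
    using f by (intro integrable_mult_indicator) auto
  have "walsh_partial_sum N A f (N ^ q) x
      = (\<Sum>n<N ^ q. LINT t|lebesgue_on {0..1}. f t * cnj (walsh_W N A n t) * walsh_W N A n x)"
    by (simp add: walsh_partial_sum_def L2_inner_def)
  also have "\<dots> = (LINT t|lebesgue_on {0..1}.
      (\<Sum>n<N ^ q. f t * cnj (walsh_W N A n t) * walsh_W N A n x))"
    using fW by (intro Bochner_Integration.integral_sum[symmetric]) simp
  also have "\<dots> = (LINT t|lebesgue_on {0..1}. 
      f t * (\<Sum>n<N ^ q. walsh_W N A n x * cnj (walsh_W N A n t)))"
    by (simp add: sum_distrib_left mult_ac)
  also have "\<dots> = (LINT t|lebesgue_on {0..1}. indicator {a..b} t *\<^sub>R (real N ^ q *\<^sub>R f t))"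
  proof (rule integral_cong_AE)
    have "(\<lambda>t. \<Sum>n<N ^ q. f t * cnj (walsh_W N A n t) * walsh_W N A n x)
        \<in> borel_measurable (lebesgue_on {0..1})"
      by (intro borel_measurable_sum borel_measurable_times borel_measurable_integrable[OF fW]) auto
    then show "(\<lambda>t. f t * (\<Sum>n<N ^ q. walsh_W N A n x * cnj (walsh_W N A n t)))
        \<in> borel_measurable (lebesgue_on {0..1})"
      by (simp add: sum_distrib_left mult_ac)
    show "AE t in lebesgue_on {0..1}. f t * (\<Sum>n<N ^ q. walsh_W N A n x * cnj (walsh_W N A n t))
        = indicator {a..b} t *\<^sub>R (real N ^ q *\<^sub>R f t)"
      using ne AE_space
    proof eventually_elim
      case (elim t)
      then have "0 \<le> t" "t < 1"
        by auto
      then have "f t * (\<Sum>n<N ^ q. walsh_W N A n x * cnj (walsh_W N A n t))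
          = f t * (if a \<le> t \<and> t < b then of_nat N ^ q else 0)"
        using x by (simp only: walsh_kernel[OF assms(1,2) A0] cell)
      moreover have "t < b \<longleftrightarrow> t \<le> b"
        using elim by linarith
      ultimately show ?case
        by (cases "a \<le> t \<and> t \<le> b") (auto simp: indicator_def scaleR_conv_of_real)
    qed
  qed (use int in simp)
  also have "\<dots> = real N ^ q *\<^sub>R integral {a..b} (\<lambda>t. if t \<in> {0..1} then f t else 0)"
  proof -
    have "(LINT t|lebesgue_on {0..1}. indicator {a..b} t *\<^sub>R (real N ^ q *\<^sub>R f t))
        = integral {0..1} (\<lambda>t. indicator {a..b} t *\<^sub>R (real N ^ q *\<^sub>R f t))"
      using int by (intro lebesgue_integral_eq_integral) auto
    also have "\<dots> = integral UNIV (\<lambda>t. if t \<in> {a..b} then real N ^ q *\<^sub>R (if t \<in> {0..1} then f t else 0) else 0)"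
      by (subst Henstock_Kurzweil_Integration.integral_restrict_UNIV[symmetric])
        (intro Henstock_Kurzweil_Integration.integral_cong, auto simp: indicator_def)
    finally show ?thesis
      by (simp only: Henstock_Kurzweil_Integration.integral_restrict_UNIV
          Henstock_Kurzweil_Integration.integral_cmul)
  qed
  also have "real N ^ q = inverse (b - a)"
    using N by (simp add: a_def b_def field_simps)
  finally show ?thesis .
qed

theorem theorem2p1:
  fixes N :: nat and A :: "complex mat" and f :: "real \<Rightarrow> complex"
  assumes "N \<ge> 2"
    and "unitary_mat N A"
    and "\<And>j. j < N \<Longrightarrow> A $$ (0, j) = 1 / complex_of_real (sqrt (real N))"
    and "integrable (lebesgue_on {0..1}) f"
  shows "AE x in lebesgue_on {0..1}.
           (\<lambda>q. walsh_partial_sum N A f (N ^ q) x) \<longlonglongrightarrow> f x"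
proof -
  define g where "g t = (if t \<in> {0..1} then f t else 0)" for t :: real
  \<comment> \<open>Extension by zero makes \<open>f\<close> integrable on every interval, as the differentiation theorem
    requires.\<close>
  have "f integrable_on {0..1}"
    using assms(4) by (intro integrable_on_lebesgue_on) auto
  then have "g integrable_on UNIV"
    unfolding g_def by (subst integrable_restrict_UNIV)
  then have "g integrable_on {a..b}" for a b
    by (rule integrable_on_subinterval) simp
  then obtain Z where Z: "negligible Z" and
    lim: "\<And>x e. x \<notin> Z \<Longrightarrow> 0 < e \<Longrightarrow>
       \<exists>d>0. \<forall>a b. a \<le> x \<and> x \<le> b \<and> a < b \<and> b - a < d \<longrightarrow>
         norm (integral {a..b} g /\<^sub>R (b - a) - g x) \<le> e"
    using Lebesgue_differentiation_real by blast
  have conv: "(\<lambda>q. walsh_partial_sum N A f (N ^ q) x) \<longlonglongrightarrow> f x"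
    if x: "0 \<le> x" "x < 1" "x \<notin> Z" for x
  proof (rule LIMSEQ_I)
    fix e :: real
    assume "0 < e"
    then obtain d where d: "d > 0" and avg: "\<And>a b. a \<le> x \<Longrightarrow> x \<le> b \<Longrightarrow> a < b \<Longrightarrow> b - a < d \<Longrightarrow>
        norm (integral {a..b} g /\<^sub>R (b - a) - g x) \<le> e / 2"
      using lim[OF x(3), of "e / 2"] by auto
    have "(\<lambda>q. inverse (real N ^ q)) \<longlonglongrightarrow> 0"
      using assms(1) by (intro LIMSEQ_inverse_realpow_zero) simp
    then have "eventually (\<lambda>q. inverse (real N ^ q) < d) sequentially"
      using d by (rule order_tendstoD)
    then obtain q0 where q0: "\<And>q. q \<ge> q0 \<Longrightarrow> inverse (real N ^ q) < d"
      unfolding eventually_sequentially by blast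
    have "norm (walsh_partial_sum N A f (N ^ q) x - f x) < e" if "q \<ge> q0" for q
    proof -
      define a b where "a = of_int \<lfloor>real N ^ q * x\<rfloor> / real N ^ q"
        and "b = of_int (\<lfloor>real N ^ q * x\<rfloor> + 1) / real N ^ q"
      have N: "real N ^ q > 0"
        using assms(1) by simp
      have ab: "a \<le> x" "x \<le> b"
        using N floor_correct[of "real N ^ q * x"]
        by (auto simp: a_def b_def pos_divide_le_eq pos_le_divide_eq mult.commute)
      have len: "b - a = inverse (real N ^ q)"
        using N by (simp add: a_def b_def field_simps)
      then have "norm (integral {a..b} g /\<^sub>R (b - a) - g x) \<le> e / 2"
        using ab N q0[OF that] by (intro avg) (auto simp: algebra_simps)
      moreover have "walsh_partial_sum N A f (N ^ q) x = integral {a..b} g /\<^sub>R (b - a)"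
        using walsh_partial_sum_eq_average[OF assms x(1,2)]
        unfolding a_def b_def g_def by simp
      ultimately show ?thesis
        using x \<open>0 < e\<close> by (simp add: g_def)
    qed
    then show "\<exists>q0. \<forall>q\<ge>q0. norm (walsh_partial_sum N A f (N ^ q) x - f x) < e"
      by blast
  qed
  have "AE x in lebesgue. x \<notin> Z"
    using Z by (simp add: negligible_iff_null_sets AE_not_in)
  moreover have "AE x in lebesgue. x \<noteq> 1"
    using AE_completion[OF AE_lborel_singleton[of 1]] by simp
  ultimately have "AE x in lebesgue. x \<in> {0..1} \<longrightarrow>
      (\<lambda>q. walsh_partial_sum N A f (N ^ q) x) \<longlonglongrightarrow> f x"
  proof eventually_elim
    case (elim x)
    then show ?case
      using conv[of x] by auto
  qed
  then show ?thesis
    by (simp add: AE_restrict_space_iff)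
qed

end
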